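(* Let $p\geq 1$ be an integer. For every integer $n\geq p$, $$\sum_{r=0}^{n}\mathbb{Q}\mathcal{R}_{p,r}=(p+1)\left(\mathbb{Q}L_{p,n+p+1}-\mathbb{Q}L_{p,p}\right)-p(n+1)I.$$
   Context: For an integer $p\geq 1$ define integer sequences indexed by $n\geq 0$. Lucas $p$-numbers: $L_{p,0}=p+1$, $L_{p,1}=\cdots=L_{p,p}=1$, $L_{p,n}=L_{p,n-1}+L_{p,n-p-1}$ for $n>p$. Lucas-Leonardo $p$-numbers: $\mathcal{R}_{p,0}=p^{2}+p+1$, $\mathcal{R}_{p,1}=\cdots=\mathcal{R}_{p,p}=1$, $\mathcal{R}_{p,n}=\mathcal{R}_{p,n-1}+\mathcal{R}_{p,n-p-1}+p$ for $n>p$. Work in the real quaternion algebra with basis $1,i,j,k$ ($i^2=j^2=-1$, $ij=-ji=k$). The Lucas $p$-quaternions and Lucas-Leonardo $p$-quaternions are $\mathbb{Q}L_{p,n}=L_{p,n}+L_{p,n+1}i+L_{p,n+2}j+L_{p,n+3}k$ and $\mathbb{Q}\mathcal{R}_{p,n}=\mathcal{R}_{p,n}+\mathcal{R}_{p,n+1}i+\mathcal{R}_{p,n+2}j+\mathcal{R}_{p,n+3}k$. Notation: $I=1+i+j+k$. *)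

theory Defs
  imports Complex_Main
begin

datatype quat = Quat (qRe: real) (qI: real) (qJ: real) (qK: real)

lemma quat_eq_iff:
  "x = y \<longleftrightarrow> qRe x = qRe y \<and> qI x = qI y \<and> qJ x = qJ y \<and> qK x = qK y"
  by (cases x; cases y) simp

instantiation quat :: real_algebra_1
begin

definition "0 = Quat 0 0 0 0"

definition "1 = Quat 1 0 0 0"

definition "x + y = Quat (qRe x + qRe y) (qI x + qI y) (qJ x + qJ y) (qK x + qK y)"

definition "- x = Quat (- qRe x) (- qI x) (- qJ x) (- qK x)"

definition "x - y = Quat (qRe x - qRe y) (qI x - qI y) (qJ x - qJ y) (qK x - qK y)"

definition "x * y = Quat
  (qRe x * qRe y - qI x * qI y - qJ x * qJ y - qK x * qK y)
  (qRe x * qI y + qI x * qRe y + qJ x * qK y - qK x * qJ y)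
  (qRe x * qJ y - qI x * qK y + qJ x * qRe y + qK x * qI y)
  (qRe x * qK y + qI x * qJ y - qJ x * qI y + qK x * qRe y)"

definition "c *\<^sub>R x = Quat (c * qRe x) (c * qI x) (c * qJ x) (c * qK x)"

instance
  by intro_classes
    (simp_all add: quat_eq_iff zero_quat_def one_quat_def plus_quat_def uminus_quat_def
      minus_quat_def times_quat_def scaleR_quat_def algebra_simps)

end

definition quat_i :: quat where "quat_i = Quat 0 1 0 0"

definition quat_j :: quat where "quat_j = Quat 0 0 1 0"

definition quat_k :: quat where "quat_k = Quat 0 0 0 1"

lemma quat_basis_expansion:
  "Quat a b c d = a *\<^sub>R 1 + b *\<^sub>R quat_i + c *\<^sub>R quat_j + d *\<^sub>R quat_k"
  by (simp add: quat_i_def quat_j_def quat_k_def one_quat_def plus_quat_def scaleR_quat_def)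

lemma quat_basis_mult:
  "quat_i * quat_i = - 1" "quat_j * quat_j = - 1"
  "quat_i * quat_j = quat_k" "quat_j * quat_i = - quat_k"
  by (simp_all add: quat_i_def quat_j_def quat_k_def one_quat_def times_quat_def uminus_quat_def)

text \<open>The clauses below also give values for \<open>p = 0\<close>; only \<open>p \<ge> 1\<close> is of interest.\<close>

function lucas :: "nat \<Rightarrow> nat \<Rightarrow> int" where
  "lucas p n =
    (if n = 0 then int p + 1
     else if n \<le> p then 1
     else lucas p (n - 1) + lucas p (n - p - 1))"
  by pat_completeness auto
termination by (relation "measure snd") auto

function lucas_leonardo :: "nat \<Rightarrow> nat \<Rightarrow> int" where
  "lucas_leonardo p n =
    (if n = 0 then (int p)\<^sup>2 + int p + 1
     else if n \<le> p then 1
     else lucas_leonardo p (n - 1) + lucas_leonardo p (n - p - 1) + int p)"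
  by pat_completeness auto
termination by (relation "measure snd") auto

declare lucas.simps [simp del] lucas_leonardo.simps [simp del]

definition lucas_quat :: "nat \<Rightarrow> nat \<Rightarrow> quat" where
  "lucas_quat p n =
    of_int (lucas p n) + of_int (lucas p (n + 1)) * quat_i
      + of_int (lucas p (n + 2)) * quat_j + of_int (lucas p (n + 3)) * quat_k"

definition lucas_leonardo_quat :: "nat \<Rightarrow> nat \<Rightarrow> quat" where
  "lucas_leonardo_quat p n =
    of_int (lucas_leonardo p n) + of_int (lucas_leonardo p (n + 1)) * quat_i
      + of_int (lucas_leonardo p (n + 2)) * quat_j + of_int (lucas_leonardo p (n + 3)) * quat_k"

end

theory Submission
  imports Defs
begin

text \<open>
  The affine map \<open>x \<mapsto> (p + 1) x - p\<close> carries the Lucas \<open>p\<close>-numbers to the Lucas-Leonardo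
  \<open>p\<close>-numbers: it matches the initial values, and it turns the homogeneous recurrence into the one
  with inhomogeneous term \<open>p\<close>, since \<open>- p = - 2 p + p\<close>. Applied componentwise, this
  (\<open>lucas_leonardo_quat_eq\<close>) reduces the sum to one of Lucas \<open>p\<close>-quaternions, the constant \<open>p\<close>
  contributing \<open>p (n + 1) I\<close>. The remaining sum telescopes (\<open>sum_lucas_quat\<close>), because the
  recurrence, shifted by \<open>p + 1\<close>, expresses each Lucas \<open>p\<close>-quaternion as the difference of two
  consecutive ones.
\<close>

lemma lucas_shift: "lucas p (n + p + 1) = lucas p (n + p) + lucas p n"
  by (subst lucas.simps) simp

lemma lucas_leonardo_eq: "lucas_leonardo p n = (int p + 1) * lucas p n - int p"
proof (induction n rule: less_induct)
  case (less n)
  show ?case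
  proof (cases "n \<le> p")
    case True
    then show ?thesis
      by (simp add: lucas_leonardo.simps[of p n] lucas.simps[of p n] power2_eq_square algebra_simps)
  next
    case False
    then show ?thesis
      using less[of "n - 1"] less[of "n - p - 1"]
      by (simp add: lucas_leonardo.simps[of p n] lucas.simps[of p n] algebra_simps)
  qed
qed

lemma lucas_leonardo_quat_eq:
  "lucas_leonardo_quat p n =
    of_nat (p + 1) * lucas_quat p n - of_nat p * (1 + quat_i + quat_j + quat_k)"
  by (simp add: lucas_leonardo_quat_def lucas_quat_def lucas_leonardo_eq algebra_simps)

lemma lucas_quat_shift: "lucas_quat p (n + p + 1) = lucas_quat p (n + p) + lucas_quat p n"
  using lucas_shift[of p n] lucas_shift[of p "n + 1"] lucas_shift[of p "n + 2"]
    lucas_shift[of p "n + 3"]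
  by (simp add: lucas_quat_def algebra_simps)

lemma sum_lucas_quat: "(\<Sum>r = 0..n. lucas_quat p r) = lucas_quat p (n + p + 1) - lucas_quat p p"
proof (induction n)
  case 0
  show ?case
    using lucas_quat_shift[of p 0] by simp
next
  case (Suc n)
  then show ?case
    using lucas_quat_shift[of p "Suc n"] by simp
qed

theorem proposition3:
  fixes p n :: nat
  assumes "p \<ge> 1" and "n \<ge> p"
  shows "(\<Sum>r = 0..n. lucas_leonardo_quat p r) =
    of_nat (p + 1) * (lucas_quat p (n + p + 1) - lucas_quat p p)
      - of_nat (p * (n + 1)) * (1 + quat_i + quat_j + quat_k)"
proof -
  let ?I = "1 + quat_i + quat_j + quat_k"
  have "(\<Sum>r = 0..n. lucas_leonardo_quat p r)
      = of_nat (p + 1) * (\<Sum>r = 0..n. lucas_quat p r) - of_nat p * (of_nat (n + 1) * ?I)"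
    unfolding lucas_leonardo_quat_eq sum_subtractf sum_distrib_left[symmetric] by simp
  also have "of_nat p * (of_nat (n + 1) * ?I) = of_nat (p * (n + 1)) * ?I"
    by (simp only: of_nat_mult mult.assoc)
  finally show ?thesis
    by (simp only: sum_lucas_quat)
qed

end
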